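(* Let $1\le n\le p$ be integers, let $X\in\mathbb{R}^{n\times p}$ be a matrix of full rank $n$, let $\beta^\star\in\mathbb{R}^p$, $\varepsilon\in\mathbb{R}^n$, $y=X\beta^\star+\varepsilon$, and let $\lambda_n^0\in\mathbb{R}$ be such that $\|X^\top\varepsilon\|_{\ell_\infty}\le\lambda_n^0$. (i) Assume that $X$ satisfies $\mathrm{UDP}(S_0,\kappa_0,\Delta)$, where $1\le S_0\le p$ and $0<\kappa_0<1/4$. Let $\lambda_d>0$ satisfy $\lambda_d>\lambda_n^0/(1-4\kappa_0)$, and let $\beta^d$ be a Dantzig selector with parameter $\lambda_d$. Then $$\|\beta^d-\beta^\star\|_{\ell_1}\le\frac{4}{\big(1-\frac{\lambda_n^0}{\lambda_d}\big)-4\kappa_0}\ \min_{\mathcal S}\Big(\lambda_d\,\Delta^2\,s+\|\beta^\star_{\mathcal S^c}\|_{\ell_1}\Big),$$ where the minimum is over all $\mathcal S\subseteq\{1,\dots,p\}$ with $|\mathcal S|=s$, $1\le s\le S_0$. (ii) Let $\rho_n>0$ be the smallest singular value of $X$ and $\delta$ the distortion of $\ker(X)$ (with no UDP assumption). For all $0<\kappa_0<1/4$, all $\lambda_d>0$ with $\lambda_d>\lambda_n^0/(1-4\kappa_0)$, every Dantzig selector $\beta^d$ with parameter $\lambda_d$, and every $\mathcal S\subseteq\{1,\dots,p\}$ with $|\mathcal S|=s$, $1\le s\le(\kappa_0/\delta)^2p$, $$\|\beta^d-\beta^\star\|_{\ell_1}\le\frac{4}{\big(1-\frac{\lambda_n^0}{\lambda_d}\big)-4\kappa_0}\Big(\lambda_d\cdot\frac{4\,\delta^2}{\rho_n^2}\cdot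 s+\|\beta^\star_{\mathcal S^c}\|_{\ell_1}\Big)$$ (i.e. the bound holds with the minimum over all such $\mathcal S$ on the right-hand side).
   Context: For $x\in\mathbb{R}^m$, $\|x\|_{\ell_1}=\sum_i|x_i|$, $\|x\|_{\ell_2}=(\sum_i x_i^2)^{1/2}$, $\|x\|_{\ell_\infty}=\max_i|x_i|$. For $\gamma\in\mathbb{R}^p$ and $\mathcal S\subseteq\{1,\dots,p\}$, $\gamma_{\mathcal S}\in\mathbb{R}^p$ is the vector with $(\gamma_{\mathcal S})_i=\gamma_i$ if $i\in\mathcal S$ and $0$ otherwise; $\mathcal S^c=\{1,\dots,p\}\setminus\mathcal S$. The singular values of the rank-$n$ matrix $X$ ($n\le p$) are $\rho_1\ge\dots\ge\rho_n>0$. Dantzig selector with parameter $\lambda_d>0$: any $$\beta^d\in\arg\min_{\beta\in\mathbb{R}^p}\|\beta\|_{\ell_1}\quad\text{subject to}\quad\|X^\top(y-X\beta)\|_{\ell_\infty}\le\lambda_d.$$ Universal Distortion Property: for $1\le S_0\le p$, $0<\kappa_0<1/2$ and $\Delta>0$, $X$ satisfies $\mathrm{UDP}(S_0,\kappa_0,\Delta)$ if for all $\gamma\in\mathbb{R}^p$, all integers $s$ with $1\le s\le S_0$, and all $\mathcal S\subseteq\{1,\dots,p\}$ with $|\mathcal S|=s$, $$\|\gamma_{\mathcal S}\|_{\ell_1}\le\Delta\sqrt s\,\|X\gamma\|_{\ell_2}+\kappa_0\|\gamma\|_{\ell_1}.$$ A subspace $\Gamma\subset\mathbb{R}^p$ has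 distortion $\delta$, with $1\le\delta\le\sqrt p$, if $\|x\|_{\ell_1}\le\sqrt p\,\|x\|_{\ell_2}\le\delta\,\|x\|_{\ell_1}$ for all $x\in\Gamma$. "The distortion" of $\Gamma$ is the smallest such $\delta$, i.e. $\delta=\sup_{x\in\Gamma\setminus\{0\}}\sqrt p\,\|x\|_{\ell_2}/\|x\|_{\ell_1}$ (and $\delta=1$ if $\Gamma=\{0\}$). *)

theory Defs
  imports "HOL-Analysis.Analysis"
begin

text \<open>
  The norms $\ell_2$ and $\ell_\infty$ on \<^typ>\<open>real ^ 'm\<close> are \<^const>\<open>norm\<close> and \<^const>\<open>infnorm\<close>.
\<close>

definition l1norm :: "real ^ 'm \<Rightarrow> real" where
  "l1norm x = (\<Sum>i\<in>UNIV. \<bar>x $ i\<bar>)"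

definition restrict_vec :: "'m set \<Rightarrow> real ^ 'm \<Rightarrow> real ^ 'm" where
  "restrict_vec S x = (\<chi> i. if i \<in> S then x $ i else 0)"

definition dantzig_selector ::
  "real ^ 'p ^ 'n \<Rightarrow> real ^ 'n \<Rightarrow> real \<Rightarrow> real ^ 'p \<Rightarrow> bool" where
  "dantzig_selector X y lam_d \<beta>d \<longleftrightarrow>
     is_arg_min l1norm (\<lambda>\<beta>. infnorm (transpose X *v (y - X *v \<beta>)) \<le> lam_d) \<beta>d"

definition UDP :: "real ^ 'p ^ 'n \<Rightarrow> nat \<Rightarrow> real \<Rightarrow> real \<Rightarrow> bool" where
  "UDP X S\<^sub>0 \<kappa>\<^sub>0 \<Delta> \<longleftrightarrow>
     1 \<le> S\<^sub>0 \<and> S\<^sub>0 \<le> CARD('p) \<and> 0 < \<kappa>\<^sub>0 \<and> \<kappa>\<^sub>0 < 1/2 \<and> 0 < \<Delta> \<and>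
     (\<forall>\<gamma> :: real ^ 'p. \<forall>s. 1 \<le> s \<and> s \<le> S\<^sub>0 \<longrightarrow> (\<forall>S. card S = s \<longrightarrow>
        l1norm (restrict_vec S \<gamma>) \<le> \<Delta> * sqrt (real s) * norm (X *v \<gamma>) + \<kappa>\<^sub>0 * l1norm \<gamma>))"

definition ker :: "real ^ 'p ^ 'n \<Rightarrow> (real ^ 'p) set" where
  "ker X = {x. X *v x = 0}"

definition distortion :: "(real ^ 'p) set \<Rightarrow> real" where
  "distortion \<Gamma> =
     (if \<Gamma> = {0} then 1
      else SUP x\<in>\<Gamma> - {0}. sqrt (real CARD('p)) * norm x / l1norm x)"

text \<open>
  A singular value is given by a pair of left and right unit singular vectors. Since both
  vectors must exist, a wide matrix of full row rank does not have \<open>0\<close> as a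
  singular value: the set below consists of the $\min(n,p)$ diagonal entries of a singular
  value decomposition, multiplicities forgotten.
\<close>

definition singular_values :: "real ^ 'p ^ 'n \<Rightarrow> real set" where
  "singular_values X =
     {\<sigma>. 0 \<le> \<sigma> \<and> (\<exists>u v. norm u = 1 \<and> norm v = 1 \<and>
        X *v v = \<sigma> *\<^sub>R u \<and> transpose X *v u = \<sigma> *\<^sub>R v)}"

definition smallest_singular_value :: "real ^ 'p ^ 'n \<Rightarrow> real" where
  "smallest_singular_value X = Min (singular_values X)"

end

theory Submission
  imports Defs
begin

text \<open>
  \<^emph>\<open>Oracle inequality.\<close> Put \<open>h = \<beta>d - \<beta>star\<close>. Since \<open>lam0 < lam_d\<close>, the vector \<open>\<beta>star\<close> is itself
  feasible, so \<open>l1norm \<beta>d \<le> l1norm \<beta>star\<close>; hence, up to the tail of \<open>\<beta>star\<close> outside \<open>S\<close>, the vector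
  \<open>h\<close> has at most as much mass outside \<open>S\<close> as inside (\<open>l1norm_le_support_tail\<close>). Feasibility of both
  vectors and \<open>l1\<close>--\<open>l\<infinity>\<close> duality bound the prediction error by
  \<open>(norm (X *v h))\<^sup>2 \<le> (lam_d + lam0) * l1norm h\<close> (\<open>prediction_error_le\<close>). The distortion inequality
  bounds the mass of \<open>h\<close> inside \<open>S\<close> by a multiple of \<open>norm (X *v h)\<close> plus a small fraction of
  \<open>l1norm h\<close>. An arithmetic-geometric mean step trades the linear occurrence of \<open>norm (X *v h)\<close> for
  a quadratic one, which is absorbed on the left (\<open>dantzig_oracle_inequality\<close>). All this concerns a
  single set \<open>S\<close>; a minimum over finitely many sets is attained at one of them.

  \<^emph>\<open>Distortion gives UDP.\<close> For the second bound the distortion inequality on \<open>S\<close> is derived from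
  the geometry of the kernel. Split \<open>\<gamma> = k + r\<close> with \<open>k\<close> in the kernel of \<open>X\<close> and \<open>r\<close> in its row
  space. The smallest singular value \<open>\<rho>\<close> controls \<open>r\<close> by \<open>\<rho> * norm r \<le> norm (X *v \<gamma>)\<close>, and the
  distortion \<open>\<delta>\<close> controls \<open>norm k\<close> by \<open>l1norm k\<close>, hence by \<open>l1norm \<gamma>\<close> and \<open>norm r\<close>. Cauchy--Schwarz
  on \<open>S\<close> turns the resulting bound on \<open>norm \<gamma>\<close> into one on the \<open>l1\<close> norm of \<open>\<gamma>\<close> restricted to \<open>S\<close>,
  and the size restriction on \<open>S\<close> makes the coefficient of \<open>l1norm \<gamma>\<close> at most \<open>\<kappa>\<close>
  (\<open>distortion_inequality_of_ker\<close>).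

  For the bound on \<open>r\<close> it is enough that the singular values form a finite set and that the minimum
  \<open>m\<close> of \<open>norm (transpose X *v u)\<close> over the unit sphere is one of them, so that \<open>\<rho> \<le> m\<close>. The latter is a first-order optimality condition
  (\<open>min_transpose_norm_is_singular_value\<close>) and avoids constructing a full singular value
  decomposition.
\<close>

section \<open>The \<open>l1\<close> norm\<close>

lemma l1norm_nonneg: "0 \<le> l1norm x"
  unfolding l1norm_def by (simp add: sum_nonneg)

lemma l1norm_triangle_sub: "l1norm (x - y) \<le> l1norm x + l1norm y"
  unfolding l1norm_def sum.distrib[symmetric] by (rule sum_mono) simp

lemma l1norm_restrict: "l1norm (restrict_vec S x) = (\<Sum>i\<in>S. \<bar>x $ i\<bar>)"
  unfolding l1norm_def restrict_vec_def by (simp add: if_distrib sum.If_cases)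

lemma l1norm_split: "l1norm x = l1norm (restrict_vec S x) + l1norm (restrict_vec (- S) x)"
  unfolding l1norm_restrict unfolding l1norm_def
  by (metis Compl_disjoint Compl_partition finite sum.union_disjoint)

lemma norm_le_l1norm: "norm x \<le> l1norm x"
  unfolding l1norm_def by (rule norm_le_l1_cart)

lemma l1norm_eq_0_iff: "l1norm x = 0 \<longleftrightarrow> x = 0"
  by (metis norm_le_l1norm norm_le_zero_iff l1norm_def abs_0 sum.neutral zero_index)

lemma l1norm_restrict_le:
  fixes x :: "real ^ 'p"
  shows "l1norm (restrict_vec S x) \<le> sqrt (real (card S)) * norm x"
proof -
  have "(\<Sum>i\<in>S. \<bar>1::real\<bar> * \<bar>x $ i\<bar>) \<le> L2_set (\<lambda>_. 1) S * L2_set (($) x) S"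
    by (rule L2_set_mult_ineq)
  also have "\<dots> \<le> L2_set (\<lambda>_. 1) S * L2_set (($) x) UNIV"
    by (intro mult_left_mono) (auto simp: L2_set_def intro!: sum_mono2)
  finally show ?thesis
    by (simp add: l1norm_restrict norm_vec_def L2_set_def)
qed

lemma l1norm_le_sqrt_norm:
  fixes x :: "real ^ 'p"
  shows "l1norm x \<le> sqrt (real CARD('p)) * norm x"
  using l1norm_restrict_le[of UNIV x] by (simp add: restrict_vec_def)

lemma inner_le_l1norm_infnorm:
  fixes x z :: "real ^ 'p"
  shows "x \<bullet> z \<le> l1norm x * infnorm z"
proof -
  have "x $ i * z $ i \<le> \<bar>x $ i\<bar> * infnorm z" for i
  proof -
    have "x $ i * z $ i \<le> \<bar>x $ i\<bar> * \<bar>z $ i\<bar>"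
      by (metis abs_ge_self abs_mult)
    also have "\<dots> \<le> \<bar>x $ i\<bar> * infnorm z"
      by (intro mult_left_mono component_le_infnorm_cart) auto
    finally show ?thesis .
  qed
  then show ?thesis
    by (simp add: inner_vec_def l1norm_def sum_distrib_right sum_mono)
qed

section \<open>The oracle inequality on one support set\<close>

text \<open>
  In passing from \<open>b\<close> to \<open>a\<close>, the mass on \<open>S\<close> drops by at most that of \<open>a - b\<close> on \<open>S\<close>. Since \<open>a\<close> has
  no more mass than \<open>b\<close>, the mass off \<open>S\<close> grows by no more than this drop, and the mass of \<open>a - b\<close>
  off \<open>S\<close> exceeds this growth by at most twice the tail of \<open>b\<close>.
\<close>

lemma l1norm_le_support_tail:
  assumes "l1norm a \<le> l1norm b"
  shows "l1norm (a - b) \<le> 2 * l1norm (restrict_vec S (a - b)) + 2 * l1norm (restrict_vec (- S) b)"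
proof -
  have on: "l1norm (restrict_vec S b) \<le> l1norm (restrict_vec S a) + l1norm (restrict_vec S (a - b))"
    unfolding l1norm_restrict sum.distrib[symmetric] by (rule sum_mono) simp
  have off: "l1norm (restrict_vec (- S) (a - b)) \<le> l1norm (restrict_vec (- S) a) + l1norm (restrict_vec (- S) b)"
    unfolding l1norm_restrict sum.distrib[symmetric] by (rule sum_mono) simp
  show ?thesis
    using on off assms l1norm_split[of a S] l1norm_split[of b S] l1norm_split[of "a - b" S]
    by linarith
qed

text \<open>
  Both residuals have small correlations with the columns of \<open>X\<close>, so \<open>transpose X *v (X *v h)\<close> is
  small in the sup norm; pair it with \<open>h\<close>.
\<close>

lemma prediction_error_le:
  fixes X :: "real ^ 'p ^ 'n"
  assumes "infnorm (transpose X *v (y - X *v a)) \<le> c"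
    and "infnorm (transpose X *v (y - X *v b)) \<le> d"
  shows "(norm (X *v (a - b)))\<^sup>2 \<le> (c + d) * l1norm (a - b)"
proof -
  have "transpose X *v (X *v (a - b)) = transpose X *v (y - X *v b) - transpose X *v (y - X *v a)"
    by (simp add: matrix_vector_mult_diff_distrib)
  then have inf: "infnorm (transpose X *v (X *v (a - b))) \<le> c + d"
    using infnorm_triangle[of "transpose X *v (y - X *v b)" "- (transpose X *v (y - X *v a))"] assms
    by (simp add: infnorm_neg)
  have "(norm (X *v (a - b)))\<^sup>2 = (a - b) \<bullet> (transpose X *v (X *v (a - b)))"
    by (metis dot_lmul_matrix power2_norm_eq_inner transpose_matrix_vector inner_commute)
  also have "\<dots> \<le> l1norm (a - b) * infnorm (transpose X *v (X *v (a - b)))"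
    by (rule inner_le_l1norm_infnorm)
  also have "\<dots> \<le> l1norm (a - b) * (c + d)"
    using inf l1norm_nonneg by (rule mult_left_mono)
  finally show ?thesis
    by (simp add: mult.commute)
qed

lemma noise_gap_pos:
  fixes \<kappa> lam lam0 :: real
  assumes "\<kappa> < 1/4" "0 < lam" "lam0 / (1 - 4 * \<kappa>) < lam"
  shows "0 < (1 - lam0 / lam) - 4 * \<kappa>"
proof -
  have "lam0 < lam * (1 - 4 * \<kappa>)"
    using assms by (simp add: pos_divide_less_eq)
  then show ?thesis
    using assms(2) by (simp add: field_simps)
qed

text \<open>
  The distortion inequality is required only for one set \<open>S\<close> and for the single vector \<open>\<beta>d - \<beta>star\<close>,
  so that both parts of the main result are instances.
\<close>

lemma dantzig_oracle_inequality:
  fixes X :: "real ^ 'p ^ 'n" and \<beta>d \<beta>star :: "real ^ 'p" and S :: "'p set"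
  assumes noise: "infnorm (transpose X *v (y - X *v \<beta>star)) \<le> lam0"
    and \<kappa>: "0 < \<kappa>" "\<kappa> < 1/4"
    and lam: "0 < lam" "lam0 / (1 - 4 * \<kappa>) < lam"
    and sel: "dantzig_selector X y lam \<beta>d"
    and dist: "l1norm (restrict_vec S (\<beta>d - \<beta>star))
      \<le> \<Delta> * sqrt (real (card S)) * norm (X *v (\<beta>d - \<beta>star)) + \<kappa> * l1norm (\<beta>d - \<beta>star)"
  shows "l1norm (\<beta>d - \<beta>star) \<le> 4 / ((1 - lam0 / lam) - 4 * \<kappa>) *
      (lam * \<Delta>\<^sup>2 * real (card S) + l1norm (restrict_vec (- S) \<beta>star))"
proof -
  define c where "c = (1 - lam0 / lam) - 4 * \<kappa>"
  define h where "h = \<beta>d - \<beta>star"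
  define t where "t = norm (X *v h)"
  define a where "a = \<Delta> * sqrt (real (card S))"
  define T where "T = l1norm (restrict_vec (- S) \<beta>star)"
  have c: "0 < c"
    unfolding c_def using noise_gap_pos \<kappa> lam by blast
  then have "lam0 / lam < 1"
    using \<kappa> by (simp add: c_def)
  then have "lam0 < lam"
    using lam by simp
  then have star: "infnorm (transpose X *v (y - X *v \<beta>star)) \<le> lam"
    using noise by linarith
  have feas: "infnorm (transpose X *v (y - X *v \<beta>d)) \<le> lam"
    and min: "l1norm \<beta>d \<le> l1norm \<beta>star"
    using sel star unfolding dantzig_selector_def is_arg_min_def by (auto simp: not_less)
  have pred: "t\<^sup>2 / lam \<le> (1 + lam0 / lam) * l1norm h"
    using prediction_error_le[OF feas noise] lam unfolding t_def h_def by (simp add: field_simps)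
  have "l1norm h \<le> 2 * (a * t + \<kappa> * l1norm h) + 2 * T"
  proof -
    have "l1norm h \<le> 2 * l1norm (restrict_vec S h) + 2 * T"
      unfolding h_def T_def by (rule l1norm_le_support_tail[OF min])
    also have "\<dots> \<le> 2 * (a * t + \<kappa> * l1norm h) + 2 * T"
      using dist by (intro add_right_mono mult_left_mono) (simp_all add: h_def t_def a_def)
    finally show ?thesis .
  qed
  \<comment> \<open>The weight \<open>lam\<close> is the one for which \<open>t\<^sup>2\<close> returns as \<open>1 + lam0 / lam\<close> copies of \<open>l1norm h\<close>,
    leaving \<open>1 - lam0 / lam\<close> of the two copies on the left after doubling.\<close>
  moreover have "4 * (a * t) \<le> 4 * (lam * a\<^sup>2) + t\<^sup>2 / lam"
  proof -
    have "0 \<le> (2 * lam * a - t)\<^sup>2 / lam"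
      using lam by simp
    also have "(2 * lam * a - t)\<^sup>2 / lam = 4 * (lam * a\<^sup>2) + t\<^sup>2 / lam - 4 * (a * t)"
      using lam by (simp add: power2_eq_square field_simps)
    finally show ?thesis by simp
  qed
  ultimately have "c * l1norm h \<le> 4 * (lam * a\<^sup>2 + T)"
    using pred unfolding c_def by (simp add: algebra_simps)
  then have "l1norm h \<le> 4 / c * (lam * a\<^sup>2 + T)"
    using c by (simp add: field_simps)
  then show ?thesis
    by (simp add: h_def c_def a_def T_def power_mult_distrib mult.assoc)
qed

section \<open>Singular values of a matrix of full row rank\<close>

lemma inner_matrix_transpose:
  fixes X :: "real ^ 'p ^ 'n"
  shows "(X *v x) \<bullet> u = x \<bullet> (transpose X *v u)"
  by (metis dot_lmul_matrix transpose_matrix_vector inner_commute)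

text \<open>
  Left singular vectors are eigenvectors of the symmetric matrix \<open>X ** transpose X\<close>; for distinct
  singular values they are orthogonal, hence linearly independent.
\<close>

lemma finite_singular_values:
  fixes X :: "real ^ 'p ^ 'n"
  shows "finite (singular_values X)"
proof -
  have "\<forall>\<sigma>\<in>singular_values X. \<exists>u. norm u = 1 \<and> X *v (transpose X *v u) = \<sigma>\<^sup>2 *\<^sub>R u"
  proof
    fix \<sigma> assume "\<sigma> \<in> singular_values X"
    then obtain u v where "norm u = 1" "X *v v = \<sigma> *\<^sub>R u" "transpose X *v u = \<sigma> *\<^sub>R v"
      unfolding singular_values_def by blast
    then have "X *v (transpose X *v u) = \<sigma>\<^sup>2 *\<^sub>R u"
      by (simp add: matrix_vector_mult_scaleR power2_eq_square)
    with \<open>norm u = 1\<close> show "\<exists>u. norm u = 1 \<and> X *v (transpose X *v u) = \<sigma>\<^sup>2 *\<^sub>R u"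
      by blast
  qed
  then obtain f :: "real \<Rightarrow> real ^ 'n"
    where f1: "norm (f \<sigma>) = 1" and f2: "X *v (transpose X *v f \<sigma>) = \<sigma>\<^sup>2 *\<^sub>R f \<sigma>"
    if "\<sigma> \<in> singular_values X" for \<sigma>
    by metis
  have orth: "f \<sigma> \<bullet> f \<tau> = 0"
    if "\<sigma> \<in> singular_values X" "\<tau> \<in> singular_values X" "\<sigma> \<noteq> \<tau>" for \<sigma> \<tau>
  proof -
    have "(X *v (transpose X *v f \<sigma>)) \<bullet> f \<tau> = f \<sigma> \<bullet> (X *v (transpose X *v f \<tau>))"
      by (metis inner_matrix_transpose inner_commute)
    then have "\<sigma>\<^sup>2 * (f \<sigma> \<bullet> f \<tau>) = \<tau>\<^sup>2 * (f \<sigma> \<bullet> f \<tau>)"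
      using f2 that by simp
    moreover have "\<sigma>\<^sup>2 \<noteq> \<tau>\<^sup>2"
      using that by (auto simp: singular_values_def)
    ultimately show ?thesis by simp
  qed
  have "inj_on f (singular_values X)"
    using orth f1 by (metis inj_onI inner_eq_zero_iff norm_zero zero_neq_one)
  moreover have "finite (f ` singular_values X)"
  proof (rule pairwise_orthogonal_imp_finite)
    show "pairwise orthogonal (f ` singular_values X)"
      unfolding pairwise_def orthogonal_def using orth by blast
  qed
  ultimately show ?thesis
    using finite_imageD by blast
qed

text \<open>
  The quadratic form \<open>Q u = (norm (transpose X *v u))\<^sup>2 - (m * norm u)\<^sup>2\<close> is nonnegative and vanishes
  at the minimiser \<open>u0\<close>. Half its gradient there, \<open>g\<close>, must vanish too, for otherwise a small step from
  \<open>u0\<close> along \<open>- g\<close> would make \<open>Q\<close> negative. Thus \<open>u0\<close> is an eigenvector of \<open>X ** transpose X\<close> and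
  \<open>transpose X *v u0 /\<^sub>R m\<close> is the right singular vector that belongs to it.
\<close>

lemma min_transpose_norm_is_singular_value:
  fixes X :: "real ^ 'p ^ 'n"
  assumes m: "0 < m" and u0: "norm u0 = 1" "norm (transpose X *v u0) = m"
    and le: "\<And>u. m * norm u \<le> norm (transpose X *v u)"
  shows "m \<in> singular_values X"
proof -
  define g where "g = X *v (transpose X *v u0) - m\<^sup>2 *\<^sub>R u0"
  define q where "q = (norm (transpose X *v g))\<^sup>2 - (m * norm g)\<^sup>2"
  have norm_sq: "(norm (a - t *\<^sub>R b))\<^sup>2 = (norm a)\<^sup>2 - 2 * t * (a \<bullet> b) + t\<^sup>2 * (norm b)\<^sup>2"
    for t :: real and a b :: "real ^ 'k"
    unfolding power2_norm_eq_inner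
    by (simp add: inner_diff inner_commute power2_eq_square algebra_simps)
  have step: "2 * t * (norm g)\<^sup>2 \<le> t\<^sup>2 * q" for t :: real
  proof -
    have "(m * norm (u0 - t *\<^sub>R g))\<^sup>2 \<le> (norm (transpose X *v (u0 - t *\<^sub>R g)))\<^sup>2"
      by (intro power_mono le) (use m in auto)
    then have ineq: "m\<^sup>2 * (1\<^sup>2 - 2 * t * (u0 \<bullet> g) + t\<^sup>2 * (norm g)\<^sup>2)
        \<le> m\<^sup>2 - 2 * t * ((transpose X *v u0) \<bullet> (transpose X *v g)) + t\<^sup>2 * (norm (transpose X *v g))\<^sup>2"
      unfolding matrix_vector_mult_diff_distrib matrix_vector_mult_scaleR power_mult_distrib
        norm_sq u0 .
    have "(norm g)\<^sup>2 = (X *v (transpose X *v u0) - m\<^sup>2 *\<^sub>R u0) \<bullet> g"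
      unfolding power2_norm_eq_inner by (simp only: g_def)
    then have "(transpose X *v u0) \<bullet> (transpose X *v g) = (norm g)\<^sup>2 + m\<^sup>2 * (u0 \<bullet> g)"
      by (simp add: inner_diff_left inner_matrix_transpose)
    from ineq[unfolded this] show ?thesis
      unfolding q_def by (simp add: algebra_simps power_mult_distrib)
  qed
  have "g = 0"
  proof (rule ccontr)
    assume "g \<noteq> 0"
    then have pos: "0 < (norm g)\<^sup>2" by simp
    moreover have "2 * (norm g)\<^sup>2 \<le> q"
      using step[of 1] by simp
    ultimately have "0 < q" by linarith
    \<comment> \<open>The step length that minimises \<open>q * t\<^sup>2 - 2 * (norm g)\<^sup>2 * t\<close>.\<close>
    have "2 * ((norm g)\<^sup>2 / q) * (norm g)\<^sup>2 \<le> ((norm g)\<^sup>2 / q)\<^sup>2 * q"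
      by (rule step)
    then have "2 * ((norm g)\<^sup>2)\<^sup>2 \<le> ((norm g)\<^sup>2)\<^sup>2"
      using \<open>0 < q\<close> by (simp add: power2_eq_square field_simps)
    with pos show False by simp
  qed
  then have eig: "X *v (transpose X *v u0) = m\<^sup>2 *\<^sub>R u0"
    by (simp add: g_def)
  define v where "v = (1 / m) *\<^sub>R (transpose X *v u0)"
  have "norm v = 1"
    using u0 m by (simp add: v_def)
  moreover have "X *v v = m *\<^sub>R u0"
    using m unfolding v_def matrix_vector_mult_scaleR eig by (simp add: power2_eq_square)
  moreover have "transpose X *v u0 = m *\<^sub>R v"
    using m by (simp add: v_def)
  ultimately show ?thesis
    unfolding singular_values_def using m u0(1) by auto
qed

lemma transpose_mult_eq_0_imp:
  fixes X :: "real ^ 'p ^ 'n"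
  assumes "rank X = CARD('n)" "transpose X *v u = 0"
  shows "u = 0"
proof -
  have "inj ((*v) (transpose X))"
    using assms(1) full_rank_injective[of "transpose X"] by (simp add: rank_transpose)
  then show ?thesis
    using assms(2) by (metis injD matrix_vector_mult_0_right)
qed

text \<open>
  Full row rank excludes the singular value \<open>0\<close>: a left singular vector for it would be a unit
  vector killed by \<open>transpose X\<close>.
\<close>

lemma smallest_singular_value_full_rank:
  fixes X :: "real ^ 'p ^ 'n"
  assumes rank: "rank X = CARD('n)"
  shows "0 < smallest_singular_value X"
    and "smallest_singular_value X * norm u \<le> norm (transpose X *v u)"
proof -
  have "compact (sphere (0 :: real ^ 'n) 1)" by simp
  moreover have "sphere (0 :: real ^ 'n) 1 \<noteq> {}"
    by simp
  moreover have "continuous_on (sphere 0 1) (\<lambda>u. norm (transpose X *v u))"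
    by (intro continuous_intros linear_continuous_on matrix_vector_mul_bounded_linear)
  ultimately obtain u0 where u0: "norm u0 = 1"
    and min: "\<And>u. norm u = 1 \<Longrightarrow> norm (transpose X *v u0) \<le> norm (transpose X *v u)"
    using continuous_attains_inf[of "sphere 0 1" "\<lambda>u. norm (transpose X *v u)"] by auto
  define m where "m = norm (transpose X *v u0)"
  have "0 < m"
    using transpose_mult_eq_0_imp[OF rank, of u0] u0 by (auto simp: m_def)
  have le: "m * norm w \<le> norm (transpose X *v w)" for w
  proof (cases "w = 0")
    case False
    then have "m \<le> norm (transpose X *v ((1 / norm w) *\<^sub>R w))"
      unfolding m_def by (intro min) simp
    with False show ?thesis
      by (simp add: matrix_vector_mult_scaleR field_simps)
  qed simp
  have mem: "m \<in> singular_values X"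
    using min_transpose_norm_is_singular_value[OF \<open>0 < m\<close> u0 m_def[symmetric] le] .
  then have "smallest_singular_value X \<in> singular_values X"
    unfolding smallest_singular_value_def using finite_singular_values by (intro Min_in) auto
  then obtain \<sigma> u' v where \<sigma>: "smallest_singular_value X = \<sigma>" "0 \<le> \<sigma>" "norm u' = 1"
    "transpose X *v u' = \<sigma> *\<^sub>R v"
    unfolding singular_values_def by blast
  have "\<sigma> \<noteq> 0"
    using transpose_mult_eq_0_imp[OF rank, of u'] \<sigma> by auto
  with \<sigma> show "0 < smallest_singular_value X" by simp
  have "smallest_singular_value X \<le> m"
    unfolding smallest_singular_value_def using finite_singular_values mem by (rule Min_le)
  then show "smallest_singular_value X * norm u \<le> norm (transpose X *v u)"
    using le[of u] by (meson mult_right_mono norm_ge_zero order_trans)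
qed

text \<open>
  The row space component \<open>transpose X *v w\<close> comes from solving the normal equations
  \<open>X *v (transpose X *v w) = X *v \<gamma>\<close>, which are solvable because \<open>X ** transpose X\<close> is injective.
  Pairing it with itself gives the bound, by the estimate for \<open>transpose X\<close>.
\<close>

lemma kernel_row_space_decomposition:
  fixes X :: "real ^ 'p ^ 'n"
  assumes rank: "rank X = CARD('n)"
  obtains k r where "\<gamma> = k + r" "k \<in> ker X"
    "smallest_singular_value X * norm r \<le> norm (X *v \<gamma>)"
proof -
  let ?\<rho> = "smallest_singular_value X"
  let ?G = "X ** transpose X"
  have "w = 0" if "?G *v w = 0" for w
  proof -
    have "(transpose X *v w) \<bullet> (transpose X *v w) = (?G *v w) \<bullet> w"
      by (metis inner_matrix_transpose matrix_vector_mul_assoc)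
    with that have "transpose X *v w = 0" by simp
    with rank show ?thesis by (rule transpose_mult_eq_0_imp)
  qed
  then have "inj ((*v) ?G)"
    using matrix_left_invertible_ker matrix_left_invertible_injective by blast
  then have "surj ((*v) ?G)"
    by (simp add: linear_injective_imp_surjective)
  then obtain w where w: "?G *v w = X *v \<gamma>"
    by (metis surjD)
  define r where "r = transpose X *v w"
  have Xr: "X *v r = X *v \<gamma>"
    using w by (simp add: r_def matrix_vector_mul_assoc del: transpose_matrix_vector)
  have "?\<rho> * norm r \<le> norm (X *v \<gamma>)"
  proof (cases "r = 0")
    case False
    have "norm r * norm r = (X *v r) \<bullet> w"
      by (simp add: inner_matrix_transpose r_def flip: power2_eq_square power2_norm_eq_inner)
    also have "\<dots> \<le> norm (X *v \<gamma>) * norm w"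
      unfolding Xr by (rule norm_cauchy_schwarz)
    finally have "?\<rho> * (norm r * norm r) \<le> ?\<rho> * (norm (X *v \<gamma>) * norm w)"
      using smallest_singular_value_full_rank(1)[OF rank] by (intro mult_left_mono) auto
    also have "\<dots> = norm (X *v \<gamma>) * (?\<rho> * norm w)"
      by simp
    also have "\<dots> \<le> norm (X *v \<gamma>) * norm r"
      unfolding r_def by (intro mult_left_mono smallest_singular_value_full_rank(2)[OF rank]) simp
    finally show ?thesis
      using False by simp
  qed simp
  moreover have "\<gamma> - r \<in> ker X"
    using Xr by (simp add: ker_def matrix_vector_mult_diff_distrib)
  ultimately show thesis
    using that[of "\<gamma> - r" r] by simp
qed

section \<open>From the distortion of the kernel to the distortion inequality\<close>

text \<open>
  The supremum that defines the distortion is over a set bounded by \<open>sqrt (real CARD('p))\<close>, because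
  the \<open>l2\<close> norm is at most the \<open>l1\<close> norm; each quotient is at least \<open>1\<close> by Cauchy--Schwarz.
\<close>

lemma distortion_properties:
  fixes \<Gamma> :: "(real ^ 'p) set"
  assumes zero: "0 \<in> \<Gamma>"
  shows distortion_ge_1: "1 \<le> distortion \<Gamma>"
    and distortion_bound: "x \<in> \<Gamma> \<Longrightarrow> sqrt (real CARD('p)) * norm x \<le> distortion \<Gamma> * l1norm x"
proof -
  let ?Q = "\<lambda>x :: real ^ 'p. sqrt (real CARD('p)) * norm x / l1norm x"
  have pos: "0 < l1norm x" if "x \<noteq> 0" for x :: "real ^ 'p"
    using that l1norm_nonneg[of x] l1norm_eq_0_iff[of x] by linarith
  have "bdd_above (?Q ` (\<Gamma> - {0}))"
  proof (rule bdd_aboveI2)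
    fix x :: "real ^ 'p" assume "x \<in> \<Gamma> - {0}"
    then show "?Q x \<le> sqrt (real CARD('p))"
      using pos[of x] norm_le_l1norm[of x] by (simp add: divide_le_eq)
  qed
  then have upper: "?Q x \<le> distortion \<Gamma>" if "x \<in> \<Gamma>" "x \<noteq> 0" for x
    using that unfolding distortion_def by (auto intro: cSUP_upper)
  show "1 \<le> distortion \<Gamma>"
  proof (cases "\<Gamma> = {0}")
    case True
    then show ?thesis by (simp add: distortion_def)
  next
    case False
    with zero obtain x where x: "x \<in> \<Gamma>" "x \<noteq> 0" by blast
    have "1 \<le> ?Q x"
      using l1norm_le_sqrt_norm[of x] pos[OF x(2)] by (simp add: le_divide_eq)
    with upper[OF x] show ?thesis by linarith
  qed
  show "sqrt (real CARD('p)) * norm x \<le> distortion \<Gamma> * l1norm x" if "x \<in> \<Gamma>"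
  proof (cases "x = 0")
    case True
    then show ?thesis by (simp add: l1norm_eq_0_iff[THEN iffD2])
  next
    case False
    from upper[OF that False] pos[OF False] show ?thesis
      by (simp add: divide_le_eq)
  qed
qed

text \<open>
  Passing from \<open>l1norm k\<close> to \<open>l1norm \<gamma>\<close> costs \<open>l1norm r \<le> sqrt p * norm r\<close>, so \<open>norm r\<close> enters
  the bound on \<open>norm \<gamma>\<close> with the factor \<open>1 + \<delta> \<le> 2 * \<delta>\<close>. This is the origin of the constant
  \<open>2 * \<delta> / \<rho>\<close>.
\<close>

lemma distortion_inequality_of_ker:
  fixes X :: "real ^ 'p ^ 'n" and S :: "'p set"
  defines "\<delta> \<equiv> distortion (ker X)" and "\<rho> \<equiv> smallest_singular_value X"
  assumes rank: "rank X = CARD('n)" and \<kappa>: "0 < \<kappa>"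
    and card: "real (card S) \<le> (\<kappa> / \<delta>)\<^sup>2 * real CARD('p)"
  shows "l1norm (restrict_vec S \<gamma>)
    \<le> 2 * \<delta> / \<rho> * sqrt (real (card S)) * norm (X *v \<gamma>) + \<kappa> * l1norm \<gamma>"
proof -
  define P where "P = sqrt (real CARD('p))"
  define s where "s = sqrt (real (card S))"
  have P: "0 < P" by (simp add: P_def)
  have \<delta>: "1 \<le> \<delta>" and bound: "\<And>x. x \<in> ker X \<Longrightarrow> P * norm x \<le> \<delta> * l1norm x"
    unfolding \<delta>_def P_def by (auto intro!: distortion_ge_1 distortion_bound simp: ker_def)
  have \<rho>: "0 < \<rho>"
    unfolding \<rho>_def using rank by (rule smallest_singular_value_full_rank)
  obtain k r where kr: "\<gamma> = k + r" "k \<in> ker X" "\<rho> * norm r \<le> norm (X *v \<gamma>)"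
    unfolding \<rho>_def using kernel_row_space_decomposition[OF rank] .
  have "P * norm k \<le> \<delta> * l1norm k"
    using bound kr by blast
  also have "\<dots> \<le> \<delta> * (l1norm \<gamma> + P * norm r)"
    using l1norm_triangle_sub[of \<gamma> r] l1norm_le_sqrt_norm[of r] \<delta> kr(1)
    by (intro mult_left_mono) (auto simp: P_def)
  finally have k: "norm k \<le> \<delta> / P * l1norm \<gamma> + \<delta> * norm r"
    using P by (simp add: field_simps)
  have "1 * norm r \<le> \<delta> * norm r"
    using \<delta> by (intro mult_right_mono) auto
  then have "norm \<gamma> \<le> \<delta> / P * l1norm \<gamma> + 2 * \<delta> * norm r"
    using norm_triangle_ineq[of k r] k unfolding kr(1)[symmetric] by linarith
  moreover have "2 * \<delta> * norm r \<le> 2 * \<delta> / \<rho> * norm (X *v \<gamma>)"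
    using kr(3) \<rho> \<delta> by (simp add: field_simps)
  ultimately have "norm \<gamma> \<le> 2 * \<delta> / \<rho> * norm (X *v \<gamma>) + \<delta> / P * l1norm \<gamma>"
    by linarith
  then have "s * norm \<gamma> \<le> s * (2 * \<delta> / \<rho> * norm (X *v \<gamma>) + \<delta> / P * l1norm \<gamma>)"
    by (intro mult_left_mono) (auto simp: s_def)
  moreover have "s * (\<delta> / P) * l1norm \<gamma> \<le> \<kappa> * l1norm \<gamma>"
  proof (intro mult_right_mono l1norm_nonneg)
    have "s \<le> sqrt ((\<kappa> / \<delta>)\<^sup>2 * real CARD('p))"
      unfolding s_def using card by (rule real_sqrt_le_mono)
    also have "\<dots> = \<kappa> / \<delta> * P"
      using \<kappa> \<delta> by (simp add: real_sqrt_mult P_def)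
    finally show "s * (\<delta> / P) \<le> \<kappa>"
      using P \<delta> by (simp add: field_simps)
  qed
  ultimately show ?thesis
    using l1norm_restrict_le[of S \<gamma>] unfolding s_def[symmetric] by (simp add: algebra_simps)
qed

section \<open>The error bounds for the Dantzig selector\<close>

theorem theorem2p3:
  fixes X :: "real ^ 'p ^ 'n"
    and \<beta>star :: "real ^ 'p"
    and \<epsilon> y :: "real ^ 'n"
    and lam0 :: real
  assumes "CARD('n) \<le> CARD('p)"
    and "rank X = CARD('n)"
    and "y = X *v \<beta>star + \<epsilon>"
    and "infnorm (transpose X *v \<epsilon>) \<le> lam0"
  shows
    "(\<forall>(S\<^sub>0::nat) (\<kappa>\<^sub>0::real) (\<Delta>::real) (lam_d::real) (\<beta>d::real ^ 'p).
        UDP X S\<^sub>0 \<kappa>\<^sub>0 \<Delta> \<and> 1 \<le> S\<^sub>0 \<and> S\<^sub>0 \<le> CARD('p) \<and> 0 < \<kappa>\<^sub>0 \<and> \<kappa>\<^sub>0 < 1/4 \<and>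
        0 < lam_d \<and> lam0 / (1 - 4 * \<kappa>\<^sub>0) < lam_d \<and> dantzig_selector X y lam_d \<beta>d \<longrightarrow>
        l1norm (\<beta>d - \<beta>star) \<le>
          4 / ((1 - lam0 / lam_d) - 4 * \<kappa>\<^sub>0) *
          (MIN S \<in> {S :: 'p set. 1 \<le> card S \<and> card S \<le> S\<^sub>0}.
             lam_d * \<Delta>\<^sup>2 * real (card S) + l1norm (restrict_vec (- S) \<beta>star)))
     \<and>
     (\<forall>(\<rho>n::real) (\<delta>::real) (\<kappa>\<^sub>0::real) (lam_d::real) (\<beta>d::real ^ 'p) (S::'p set).
        \<rho>n = smallest_singular_value X \<and> \<delta> = distortion (ker X) \<and>
        0 < \<kappa>\<^sub>0 \<and> \<kappa>\<^sub>0 < 1/4 \<and>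
        0 < lam_d \<and> lam0 / (1 - 4 * \<kappa>\<^sub>0) < lam_d \<and> dantzig_selector X y lam_d \<beta>d \<and>
        1 \<le> card S \<and> real (card S) \<le> (\<kappa>\<^sub>0 / \<delta>)\<^sup>2 * real CARD('p) \<longrightarrow>
        l1norm (\<beta>d - \<beta>star) \<le>
          4 / ((1 - lam0 / lam_d) - 4 * \<kappa>\<^sub>0) *
          (lam_d * (4 * \<delta>\<^sup>2 / \<rho>n\<^sup>2) * real (card S) + l1norm (restrict_vec (- S) \<beta>star)))"
proof -
  have noise: "infnorm (transpose X *v (y - X *v \<beta>star)) \<le> lam0"
    using assms(3,4) by simp
  show ?thesis
  proof (intro conjI allI impI, goal_cases)
    case (1 S\<^sub>0 \<kappa> \<Delta> lam \<beta>d)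
    let ?A = "{S :: 'p set. 1 \<le> card S \<and> card S \<le> S\<^sub>0}"
    let ?f = "\<lambda>S. lam * \<Delta>\<^sup>2 * real (card S) + l1norm (restrict_vec (- S) \<beta>star)"
    have "{undefined :: 'p} \<in> ?A"
      using 1 by simp
    then have "?A \<noteq> {}"
      by blast
    then have "Min (?f ` ?A) \<in> ?f ` ?A"
      by (intro Min_in) (simp_all del: Collect_empty_eq)
    then obtain S where S: "S \<in> ?A" "Min (?f ` ?A) = ?f S"
      by blast
    have "l1norm (\<beta>d - \<beta>star) \<le> 4 / ((1 - lam0 / lam) - 4 * \<kappa>) * ?f S"
      by (rule dantzig_oracle_inequality[OF noise]) (use 1 S in \<open>auto simp: UDP_def\<close>)
    then show ?case
      by (simp only: S(2))
  next
    case (2 \<rho> \<delta> \<kappa> lam \<beta>d S)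
    have "l1norm (\<beta>d - \<beta>star) \<le> 4 / ((1 - lam0 / lam) - 4 * \<kappa>) *
        (lam * (2 * \<delta> / \<rho>)\<^sup>2 * real (card S) + l1norm (restrict_vec (- S) \<beta>star))"
      by (rule dantzig_oracle_inequality[OF noise])
        (use 2 distortion_inequality_of_ker[OF assms(2)] in auto)
    then show ?case
      by (simp add: power_divide power_mult_distrib)
  qed
qed

end
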